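(* Let $A$ be a commutative ring whose underlying abelian group is torsion-free, and suppose that $A$ is finitely generated as a commutative ring. Then, for each integer $m$, the degree $m$ summand $L^A_m$ of the classifying ring $L^A$ of formal $A$-modules is a finitely generated $A$-module.
   Context: For a commutative ring $A$ and a commutative $A$-algebra $R$, a (one-dimensional) formal $A$-module over $R$ is a formal group law $F(X,Y)\in R[[X,Y]]$ together with a ring homomorphism $\rho: A\to \mathrm{End}(F)$ such that $\rho(a)(X)\equiv aX \bmod X^2$ for all $a\in A$; here $\mathrm{End}(F)\subseteq R[[X]]$ has addition $F(f(X),g(X))$ and multiplication given by composition. $L^A$ is the commutative $A$-algebra corepresenting the functor sending $R$ to the set of formal $A$-modules over $R$. It is graded, concentrated in even nonnegative degrees: if the universal formal $A$-module is $F(X,Y)=\sum_{i,j} \alpha_{i,j}X^iY^j$ and $\rho(a)(X)=\sum_{i\ge 1} \rho_{a,i} X^i$, then $\alpha_{i,j}$ has degree $2(i+j-1)$ and $\rho_{a,i}$ has degree $2(i-1)$. In degree $0$ one has $L^A_0=A$. *)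

theory Defs
  imports "HOL-Algebra.Generated_Rings" "HOL-Algebra.Module" "HOL-Library.Product_Plus"
begin

section \<open>Formal power series\<close>

text \<open>
  A power series over \<open>R\<close> is the function assigning to each monomial its coefficient.  Monomials are
  exponent vectors, i.e. elements of \<^typ>\<open>nat\<close>, \<^typ>\<open>nat \<times> nat\<close>, or \<^typ>\<open>nat \<times> nat \<times> nat\<close>
  for series in one, two, or three variables, and multiply by adding exponents.
\<close>

definition pseries :: "('r, 'n) ring_scheme \<Rightarrow> ('e::comm_monoid_add \<Rightarrow> 'r) ring" where
  "pseries R =
    \<lparr> carrier = {f. range f \<subseteq> carrier R},
      mult = (\<lambda>f g e. \<Oplus>\<^bsub>R\<^esub>p\<in>{p. fst p + snd p = e}. f (fst p) \<otimes>\<^bsub>R\<^esub> g (snd p)),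
      one = (\<lambda>e. if e = 0 then \<one>\<^bsub>R\<^esub> else \<zero>\<^bsub>R\<^esub>),
      zero = (\<lambda>e. \<zero>\<^bsub>R\<^esub>),
      add = (\<lambda>f g e. f e \<oplus>\<^bsub>R\<^esub> g e) \<rparr>"

definition monomial :: "('r, 'n) ring_scheme \<Rightarrow> 'e \<Rightarrow> 'e \<Rightarrow> 'r" where
  "monomial R d = (\<lambda>e. if e = d then \<one>\<^bsub>R\<^esub> else \<zero>\<^bsub>R\<^esub>)"

text \<open>
  The substitutions \<open>f(g)\<close> and \<open>F(g, h)\<close>.  They are meant for \<open>g\<close>, \<open>h\<close> without constant term; then
  for each \<open>e\<close> only finitely many of the powers \<open>g\<^sup>i\<close> (products \<open>g\<^sup>i h\<^sup>j\<close>) have a nonzero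
  coefficient at \<open>e\<close>, and the sums below range over just those.
\<close>

definition psubst ::
  "('r, 'n) ring_scheme \<Rightarrow> (nat \<Rightarrow> 'r) \<Rightarrow> ('e::comm_monoid_add \<Rightarrow> 'r) \<Rightarrow> 'e \<Rightarrow> 'r" where
  "psubst R f g = (\<lambda>e.
    \<Oplus>\<^bsub>R\<^esub>i\<in>{i. (g [^]\<^bsub>pseries R\<^esub> (i::nat)) e \<noteq> \<zero>\<^bsub>R\<^esub>}.
      f i \<otimes>\<^bsub>R\<^esub> (g [^]\<^bsub>pseries R\<^esub> i) e)"

definition psubst2 ::
  "('r, 'n) ring_scheme \<Rightarrow> (nat \<times> nat \<Rightarrow> 'r)
    \<Rightarrow> ('e::comm_monoid_add \<Rightarrow> 'r) \<Rightarrow> ('e \<Rightarrow> 'r) \<Rightarrow> 'e \<Rightarrow> 'r" where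
  "psubst2 R F g h = (\<lambda>e.
    let gh = (\<lambda>p. (g [^]\<^bsub>pseries R\<^esub> fst p \<otimes>\<^bsub>pseries R\<^esub> h [^]\<^bsub>pseries R\<^esub> snd p) e)
    in \<Oplus>\<^bsub>R\<^esub>p\<in>{p. gh p \<noteq> \<zero>\<^bsub>R\<^esub>}. F p \<otimes>\<^bsub>R\<^esub> gh p)"


section \<open>Formal group laws and formal modules\<close>

text \<open>
  Formal group laws are commutative, as is needed for the endomorphisms to form a ring.  The existence
  of inverses follows from the axioms.
\<close>

definition formal_group_law :: "('r, 'n) ring_scheme \<Rightarrow> (nat \<times> nat \<Rightarrow> 'r) \<Rightarrow> bool" where
  "formal_group_law R F \<longleftrightarrow>
     F \<in> carrier (pseries R) \<and>
     (\<lambda>i. F (i, 0)) = monomial R 1 \<and>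
     (\<lambda>j. F (0, j)) = monomial R 1 \<and>
     (\<forall>i j. F (i, j) = F (j, i)) \<and>
     (let X = monomial R (1, 0, 0); Y = monomial R (0, 1, 0);
          Z = monomial R (0, 0, 1) :: nat \<times> nat \<times> nat \<Rightarrow> 'r
      in psubst2 R F (psubst2 R F X Y) Z = psubst2 R F X (psubst2 R F Y Z))"

definition fgl_End :: "('r, 'n) ring_scheme \<Rightarrow> (nat \<times> nat \<Rightarrow> 'r) \<Rightarrow> (nat \<Rightarrow> 'r) ring" where
  "fgl_End R F =
    \<lparr> carrier = {f \<in> carrier (pseries R). f 0 = \<zero>\<^bsub>R\<^esub> \<and>
        psubst R f F =
        psubst2 R F (psubst R f (monomial R (1, 0))) (psubst R f (monomial R (0, 1)))},
      mult = psubst R,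
      one = monomial R 1,
      zero = (\<lambda>i. \<zero>\<^bsub>R\<^esub>),
      add = psubst2 R F \<rparr>"

definition formal_module ::
  "('a, 'm) ring_scheme \<Rightarrow> ('a, 'r, 'n) module_scheme
    \<Rightarrow> (nat \<times> nat \<Rightarrow> 'r) \<Rightarrow> ('a \<Rightarrow> nat \<Rightarrow> 'r) \<Rightarrow> bool" where
  "formal_module A R F \<rho> \<longleftrightarrow>
     formal_group_law R F \<and>
     \<rho> \<in> ring_hom A (fgl_End R F) \<and>
     (\<forall>a \<in> carrier A. \<rho> a 1 = a \<odot>\<^bsub>R\<^esub> \<one>\<^bsub>R\<^esub>)"


section \<open>The classifying ring and its grading\<close>

definition algebra_hom ::
  "('a, 'm) ring_scheme \<Rightarrow> ('a, 'l, 'n) module_scheme \<Rightarrow> ('a, 'r, 'k) module_scheme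
    \<Rightarrow> ('l \<Rightarrow> 'r) set" where
  "algebra_hom A L R = {\<phi> \<in> ring_hom L R.
     \<forall>a \<in> carrier A. \<forall>x \<in> carrier L. \<phi> (a \<odot>\<^bsub>L\<^esub> x) = a \<odot>\<^bsub>R\<^esub> \<phi> x}"

text \<open>
  \<open>L\<close>, with universal formal module \<open>(F, \<rho>)\<close>, corepresents the functor sending a commutative
  \<open>A\<close>-algebra \<open>R\<close> to the set of formal \<open>A\<close>-modules over \<open>R\<close>.

  A formula cannot quantify over the type of the elements of \<open>R\<close>, so a fixed type is used, chosen
  large enough that nothing is lost.  A formal module over an arbitrary \<open>R\<close> is defined over the
  subalgebra generated by its coefficients, and that subalgebra has at most as many elements as
  \<^typ>\<open>'a list\<close>; so classifying maps exist for every \<open>R\<close>.  They are unique because \<open>L\<close> is itself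
  generated by the coefficients of \<open>(F, \<rho>)\<close>: the subalgebra they generate is among the test objects,
  as is \<open>L\<close>, owing to the summand \<^typ>\<open>'l\<close>.
\<close>

definition corepresents_formal_modules ::
  "('a, 'm) ring_scheme \<Rightarrow> ('a, 'l) module
    \<Rightarrow> (nat \<times> nat \<Rightarrow> 'l) \<Rightarrow> ('a \<Rightarrow> nat \<Rightarrow> 'l) \<Rightarrow> bool" where
  "corepresents_formal_modules A L F \<rho> \<longleftrightarrow>
     algebra A L \<and> formal_module A L F \<rho> \<and>
     (\<forall>(R :: ('a, 'l + 'a list) module) F' \<rho>'.
        algebra A R \<longrightarrow> formal_module A R F' \<rho>' \<longrightarrow>
        (\<exists>!\<phi>. \<phi> \<in> algebra_hom A L R \<and> \<phi> \<in> extensional (carrier L) \<and>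
              (\<forall>i j. \<phi> (F (i, j)) = F' (i, j)) \<and>
              (\<forall>a \<in> carrier A. \<forall>i. \<phi> (\<rho> a i) = \<rho>' a i)))"

definition graded_algebra ::
  "('a, 'm) ring_scheme \<Rightarrow> ('a, 'l, 'n) module_scheme \<Rightarrow> (int \<Rightarrow> 'l set) \<Rightarrow> bool" where
  "graded_algebra A L G \<longleftrightarrow>
     algebra A L \<and>
     (\<forall>m. submodule (G m) A L) \<and>
     \<one>\<^bsub>L\<^esub> \<in> G 0 \<and>
     (\<forall>m n. \<forall>x \<in> G m. \<forall>y \<in> G n. x \<otimes>\<^bsub>L\<^esub> y \<in> G (m + n)) \<and>
     (\<forall>x \<in> carrier L. \<exists>!c. (\<forall>m. c m \<in> G m) \<and> finite {m. c m \<noteq> \<zero>\<^bsub>L\<^esub>} \<and>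
        x = (\<Oplus>\<^bsub>L\<^esub>m\<in>{m. c m \<noteq> \<zero>\<^bsub>L\<^esub>}. c m))"

text \<open>
  The degrees prescribed here determine \<open>G\<close> when \<open>(F, \<rho>)\<close> is universal, since its coefficients then
  generate \<open>L\<close> as an \<open>A\<close>-algebra.  The coefficients \<open>F (0, 0)\<close> and \<open>\<rho> a 0\<close>, of nominal degree
  \<open>-2\<close>, are zero.
\<close>

definition classifying_grading ::
  "('a, 'm) ring_scheme \<Rightarrow> ('a, 'l, 'n) module_scheme
    \<Rightarrow> (nat \<times> nat \<Rightarrow> 'l) \<Rightarrow> ('a \<Rightarrow> nat \<Rightarrow> 'l) \<Rightarrow> (int \<Rightarrow> 'l set) \<Rightarrow> bool" where
  "classifying_grading A L F \<rho> G \<longleftrightarrow>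
     graded_algebra A L G \<and>
     (\<forall>i j. F (i, j) \<in> G (2 * (int i + int j - 1))) \<and>
     (\<forall>a \<in> carrier A. \<forall>i. \<rho> a i \<in> G (2 * (int i - 1)))"


section \<open>Finiteness conditions\<close>

definition torsion_free :: "('a, 'm) ring_scheme \<Rightarrow> bool" where
  "torsion_free A \<longleftrightarrow>
     (\<forall>n::nat. \<forall>a \<in> carrier A. n > 0 \<longrightarrow> [n] \<cdot>\<^bsub>A\<^esub> a = \<zero>\<^bsub>A\<^esub> \<longrightarrow> a = \<zero>\<^bsub>A\<^esub>)"

definition finitely_generated_ring :: "('a, 'm) ring_scheme \<Rightarrow> bool" where
  "finitely_generated_ring A \<longleftrightarrow>
     (\<exists>S. finite S \<and> S \<subseteq> carrier A \<and> generate_ring A S = carrier A)"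

definition finitely_generated_module ::
  "('a, 'm) ring_scheme \<Rightarrow> ('a, 'b, 'n) module_scheme \<Rightarrow> bool" where
  "finitely_generated_module A M \<longleftrightarrow>
     module A M \<and>
     (\<exists>S. finite S \<and> S \<subseteq> carrier M \<and>
        carrier M = {\<Oplus>\<^bsub>M\<^esub>s\<in>S. c s \<odot>\<^bsub>M\<^esub> s | c. c \<in> S \<rightarrow> carrier A})"

end

theory Submission
  imports Defs
begin

text \<open>
  By uniqueness of classifying maps, \<open>L\<close> is generated as an \<open>A\<close>-algebra by the coefficients of
  \<open>F\<close> and of all \<open>\<rho> a\<close>.  Since \<open>\<rho> (a + b) = F(\<rho> a, \<rho> b)\<close> and \<open>\<rho> (a b) = \<rho> a \<circ> \<rho> b\<close>, the elements
  \<open>a\<close> for which \<open>\<rho> a\<close> has its coefficients in a given subalgebra containing those of \<open>F\<close> and of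
  \<open>\<rho> (-1)\<close> form a subring of \<open>A\<close>; so only the \<open>\<rho> a\<close> with \<open>a = -1\<close> or \<open>a\<close> in a finite set of ring
  generators are needed.  This leaves finitely many algebra generators in each degree, all of
  positive degree once the scalars are discarded, hence finitely many monomials in each degree.
\<close>

section \<open>Linear spans\<close>

text \<open>Building a combination one term at a time gives an induction principle for an arbitrary
  \<open>S\<close>, finite or not. The rules mention only the operations of \<open>M\<close> and not
  its carrier, so the span stays the same when \<open>M\<close> is cut down to a submodule.\<close>

inductive_set module_span :: "('a, 'm) ring_scheme \<Rightarrow> ('a, 'b, 'n) module_scheme \<Rightarrow> 'b set \<Rightarrow> 'b set"
  for A M S where
    zero: "\<zero>\<^bsub>M\<^esub> \<in> module_span A M S"
  | insert: "\<lbrakk>a \<in> carrier A; s \<in> S; x \<in> module_span A M S\<rbrakk> \<Longrightarrow>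
      a \<odot>\<^bsub>M\<^esub> s \<oplus>\<^bsub>M\<^esub> x \<in> module_span A M S"

context module
begin

lemma module_span_in_carrier:
  assumes "S \<subseteq> carrier M" "x \<in> module_span R M S"
  shows "x \<in> carrier M"
  using assms(2) by induction (use assms(1) in auto)

lemma module_span_add:
  assumes S: "S \<subseteq> carrier M" and x: "x \<in> module_span R M S" and y: "y \<in> module_span R M S"
  shows "x \<oplus>\<^bsub>M\<^esub> y \<in> module_span R M S"
  using x
proof induction
  case zero
  then show ?case using y module_span_in_carrier[OF S y] by simp
next
  case (insert a s x)
  have "a \<odot>\<^bsub>M\<^esub> s \<oplus>\<^bsub>M\<^esub> x \<oplus>\<^bsub>M\<^esub> y = a \<odot>\<^bsub>M\<^esub> s \<oplus>\<^bsub>M\<^esub> (x \<oplus>\<^bsub>M\<^esub> y)"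
    using insert S y module_span_in_carrier[OF S] by (intro M.a_assoc) auto
  then show ?case using insert by (auto intro: module_span.insert)
qed

lemma module_span_smult:
  assumes S: "S \<subseteq> carrier M" and b: "b \<in> carrier R" and x: "x \<in> module_span R M S"
  shows "b \<odot>\<^bsub>M\<^esub> x \<in> module_span R M S"
  using x
proof induction
  case zero
  then show ?case using b by (auto intro: module_span.zero)
next
  case (insert a s x)
  have cl: "s \<in> carrier M" "x \<in> carrier M"
    using S insert module_span_in_carrier[OF S] by auto
  have "b \<odot>\<^bsub>M\<^esub> (a \<odot>\<^bsub>M\<^esub> s \<oplus>\<^bsub>M\<^esub> x) = (b \<otimes> a) \<odot>\<^bsub>M\<^esub> s \<oplus>\<^bsub>M\<^esub> b \<odot>\<^bsub>M\<^esub> x"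
    using cl insert(1) b by (simp add: smult_r_distr smult_assoc1)
  then show ?case using insert b by (auto intro: module_span.insert)
qed

lemma module_span_base:
  assumes "S \<subseteq> carrier M" "s \<in> S"
  shows "s \<in> module_span R M S"
  using module_span.insert[OF R.one_closed assms(2) module_span.zero[where M = M]] assms by auto

lemma module_span_submodule:
  assumes S: "S \<subseteq> carrier M"
  shows "submodule (module_span R M S) R M"
proof (rule submoduleI)
  fix x assume x: "x \<in> module_span R M S"
  have "\<ominus>\<^bsub>M\<^esub> x = (\<ominus> \<one>) \<odot>\<^bsub>M\<^esub> x"
    using smult_l_minus[of \<one> x] module_span_in_carrier[OF S x] by simp
  then show "\<ominus>\<^bsub>M\<^esub> x \<in> module_span R M S"
    using module_span_smult[OF S _ x] by simp
qed (use module_span_in_carrier[OF S] module_span_add[OF S] module_span_smult[OF S] in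
    \<open>auto intro: module_span.zero\<close>)

lemma module_span_minimal:
  assumes "submodule H R M" "S \<subseteq> H"
  shows "module_span R M S \<subseteq> H"
proof
  fix x assume "x \<in> module_span R M S"
  then show "x \<in> H"
  proof induction
    case zero
    then show ?case using subgroup.one_closed[OF submodule.axioms(1)[OF assms(1)]] by simp
  next
    case (insert a s x)
    then show ?case using submoduleE(4,5)[OF assms(1)] assms(2) by blast
  qed
qed

text \<open>Links the inductive span to the explicit sums in
  \<open>finitely_generated_module\<close>.\<close>

lemma module_span_eq_linear_combinations:
  assumes S: "S \<subseteq> carrier M" "finite S"
  shows "module_span R M S = {\<Oplus>\<^bsub>M\<^esub>s\<in>S. c s \<odot>\<^bsub>M\<^esub> s | c. c \<in> S \<rightarrow> carrier R}" (is "_ = ?C")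
proof (intro subset_antisym subsetI)
  fix x assume "x \<in> module_span R M S"
  then show "x \<in> ?C"
  proof induction
    case zero
    have "(\<Oplus>\<^bsub>M\<^esub>s\<in>S. \<zero> \<odot>\<^bsub>M\<^esub> s) = (\<Oplus>\<^bsub>M\<^esub>s\<in>S. \<zero>\<^bsub>M\<^esub>)"
      using S by (intro M.finsum_cong') auto
    then show ?case by (auto intro!: exI[of _ "\<lambda>_. \<zero>"])
  next
    case (insert a s x)
    then obtain c where c: "c \<in> S \<rightarrow> carrier R" and x: "x = (\<Oplus>\<^bsub>M\<^esub>s\<in>S. c s \<odot>\<^bsub>M\<^esub> s)" by auto
    \<comment> \<open>\<open>?d\<close> is the new term as a family supported at \<open>s\<close>.
      Adding it changes only the coefficient of \<open>s\<close>, from \<open>c s\<close> to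
      \<open>a \<oplus> c s\<close>.\<close>
    let ?d = "\<lambda>t. if s = t then a \<odot>\<^bsub>M\<^esub> t else \<zero>\<^bsub>M\<^esub>"
    define c' where "c' t = (if s = t then a \<oplus> c t else c t)" for t
    have cl: "?d \<in> S \<rightarrow> carrier M" "(\<lambda>t. c t \<odot>\<^bsub>M\<^esub> t) \<in> S \<rightarrow> carrier M"
      using S c insert by (auto simp: Pi_def)
    have "(\<Oplus>\<^bsub>M\<^esub>t\<in>S. c' t \<odot>\<^bsub>M\<^esub> t) = (\<Oplus>\<^bsub>M\<^esub>t\<in>S. ?d t \<oplus>\<^bsub>M\<^esub> c t \<odot>\<^bsub>M\<^esub> t)"
      using S c insert cl
      by (intro M.finsum_cong') (auto simp: c'_def Pi_def smult_l_distr subset_iff)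
    also have "\<dots> = (\<Oplus>\<^bsub>M\<^esub>t\<in>S. ?d t) \<oplus>\<^bsub>M\<^esub> x"
      unfolding x by (rule M.finsum_addf[OF cl])
    also have "(\<Oplus>\<^bsub>M\<^esub>t\<in>S. ?d t) = a \<odot>\<^bsub>M\<^esub> s"
      using S insert by (intro M.add.finprod_singleton) auto
    finally show ?case
      using insert c by (intro CollectI exI[of _ c']) (auto simp: c'_def Pi_def)
  qed
next
  fix x assume "x \<in> ?C"
  then obtain c where c: "c \<in> S \<rightarrow> carrier R" and x: "x = (\<Oplus>\<^bsub>M\<^esub>s\<in>S. c s \<odot>\<^bsub>M\<^esub> s)" by auto
  \<comment> \<open>The induction runs over the subsets \<open>T\<close> of \<open>S\<close>, while
    the span is that of the whole of \<open>S\<close>.\<close>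
  have "(\<Oplus>\<^bsub>M\<^esub>s\<in>T. c s \<odot>\<^bsub>M\<^esub> s) \<in> module_span R M S" if "finite T" "T \<subseteq> S" for T
    using that
  proof induction
    case empty
    then show ?case by (simp add: module_span.zero)
  next
    case (insert s T)
    then have "(\<Oplus>\<^bsub>M\<^esub>s\<in>insert s T. c s \<odot>\<^bsub>M\<^esub> s) = c s \<odot>\<^bsub>M\<^esub> s \<oplus>\<^bsub>M\<^esub> (\<Oplus>\<^bsub>M\<^esub>s\<in>T. c s \<odot>\<^bsub>M\<^esub> s)"
      using S c by (intro M.finsum_insert) (auto simp: Pi_def subset_iff)
    then show ?case using insert c by (auto intro!: module_span.insert)
  qed
  then show "x \<in> module_span R M S" using S x by auto
qed

end

lemma module_span_restrict_carrier:
  "module_span A (M\<lparr>carrier := H\<rparr>) S = module_span A M S"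
proof (intro subset_antisym subsetI)
  fix x assume "x \<in> module_span A (M\<lparr>carrier := H\<rparr>) S"
  then show "x \<in> module_span A M S"
    by induction (auto intro: module_span.intros)
next
  fix x assume "x \<in> module_span A M S"
  then show "x \<in> module_span A (M\<lparr>carrier := H\<rparr>) S"
    by induction (use module_span.intros[where M = "M\<lparr>carrier := H\<rparr>"] in auto)
qed

lemma (in module) finitely_generated_module_span:
  assumes S: "S \<subseteq> carrier M" "finite S"
  shows "finitely_generated_module R (M\<lparr>carrier := module_span R M S\<rparr>)" (is "finitely_generated_module R ?N")
proof -
  interpret N: module R ?N
    by (rule submodule.submodule_is_module[OF module_span_submodule[OF S(1)] module_axioms])
  have car: "carrier ?N = module_span R M S" by simp
  have sub: "S \<subseteq> carrier ?N" using module_span_base[OF S(1)] by auto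
  show ?thesis
    using N.module_span_eq_linear_combinations[OF sub S(2)] S(2) sub N.module_axioms
    unfolding finitely_generated_module_def module_span_restrict_carrier car by blast
qed


section \<open>Spans of homogeneous elements\<close>

text \<open>Terms of a combination are collected by index. The set \<open>N\<close> only has to
  contain the support of \<open>c\<close>: adding a term can cancel a component, so the exact
  support would not be stable under the induction.\<close>

lemma module_span_Un_decompose:
  assumes "module A M" "\<And>i. V i \<subseteq> carrier M" "x \<in> module_span A M (\<Union>i. V i)"
  shows "\<exists>c N. finite N \<and> (\<forall>i. c i \<in> module_span A M (V i)) \<and> (\<forall>i. i \<notin> N \<longrightarrow> c i = \<zero>\<^bsub>M\<^esub>) \<and>
    x = (\<Oplus>\<^bsub>M\<^esub>i\<in>N. c i)"
proof -
  interpret module A M by fact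
  note span_carrier = module_span_in_carrier[OF assms(2)]
  show ?thesis
    using assms(3)
  proof induction
    case zero
    then show ?case
      by (intro exI[of _ "\<lambda>_. \<zero>\<^bsub>M\<^esub>"] exI[of _ "{}"]) (auto intro: module_span.zero)
  next
    case (insert a s x)
    then obtain c N k where N: "finite N" and c: "\<And>i. c i \<in> module_span A M (V i)"
      and z: "\<And>i. i \<notin> N \<Longrightarrow> c i = \<zero>\<^bsub>M\<^esub>" and x: "x = (\<Oplus>\<^bsub>M\<^esub>i\<in>N. c i)" and k: "s \<in> V k"
      by blast
    let ?d = "\<lambda>i. if k = i then a \<odot>\<^bsub>M\<^esub> s else \<zero>\<^bsub>M\<^esub>"
    let ?N = "insert k N"
    have sM: "s \<in> carrier M" using k assms(2) by auto
    have cM: "c i \<in> carrier M" for i using span_carrier[OF c] .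
    have cl: "?d \<in> ?N \<rightarrow> carrier M" "c \<in> ?N \<rightarrow> carrier M"
      using insert(1) sM cM by auto
    \<comment> \<open>If \<open>k\<close> is not yet in \<open>N\<close>, then \<open>c k\<close> is
      zero, so \<open>N\<close> can be enlarged by \<open>k\<close> without changing the
      sum.\<close>
    have "(\<Oplus>\<^bsub>M\<^esub>i\<in>N. c i) = (\<Oplus>\<^bsub>M\<^esub>i\<in>?N. c i)"
      using N z cM by (intro M.add.finprod_mono_neutral_cong_left) auto
    moreover have "(\<Oplus>\<^bsub>M\<^esub>i\<in>?N. ?d i) = a \<odot>\<^bsub>M\<^esub> s"
      using insert(1) sM N by (intro M.add.finprod_singleton) auto
    ultimately have eq: "(\<Oplus>\<^bsub>M\<^esub>i\<in>?N. ?d i \<oplus>\<^bsub>M\<^esub> c i) = a \<odot>\<^bsub>M\<^esub> s \<oplus>\<^bsub>M\<^esub> x"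
      using M.finsum_addf[OF cl] x by simp
    have "?d i \<oplus>\<^bsub>M\<^esub> c i \<in> module_span A M (V i)" for i
      using insert(1) k c[of i] cM[of i] by (auto intro: module_span.insert)
    then show ?case
      using N z eq by (intro exI[of _ "\<lambda>i. ?d i \<oplus>\<^bsub>M\<^esub> c i"] exI[of _ ?N]) auto
  qed
qed

text \<open>Grouping a combination by degree gives one homogeneous decomposition of
  \<open>x\<close>; another has \<open>x\<close> alone in degree \<open>m\<close>. By uniqueness
  they coincide, so \<open>x\<close> is the component of degree \<open>m\<close> of the
  combination.\<close>

lemma graded_component_of_span:
  assumes G: "graded_algebra A L G" and V: "\<And>i. V i \<subseteq> G i"
    and x: "x \<in> module_span A L (\<Union>i. V i)" and xm: "x \<in> G m"
  shows "x \<in> module_span A L (V m)"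
proof -
  interpret algebra A L using G by (simp add: graded_algebra_def)
  have sub: "submodule (G i) A L" for i using G by (simp add: graded_algebra_def)
  have GL: "G i \<subseteq> carrier L" and G0: "\<zero>\<^bsub>L\<^esub> \<in> G i" for i
    using submoduleE(1)[OF sub] subgroup.one_closed[OF submodule.axioms(1)[OF sub]] by auto
  have VL: "V i \<subseteq> carrier L" for i using V GL by blast
  obtain c N where N: "finite N" and c: "\<And>i. c i \<in> module_span A L (V i)"
    and z: "\<And>i. i \<notin> N \<Longrightarrow> c i = \<zero>\<^bsub>L\<^esub>" and xc: "x = (\<Oplus>\<^bsub>L\<^esub>i\<in>N. c i)"
    using module_span_Un_decompose[OF module VL x] by blast
  have cG: "c i \<in> G i" for i using module_span_minimal[OF sub V] c by blast
  then have cL: "c i \<in> carrier L" for i using GL by blast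
  let ?P = "\<lambda>c. (\<forall>m. c m \<in> G m) \<and> finite {m. c m \<noteq> \<zero>\<^bsub>L\<^esub>} \<and>
        x = (\<Oplus>\<^bsub>L\<^esub>m\<in>{m. c m \<noteq> \<zero>\<^bsub>L\<^esub>}. c m)"
  have ex1: "\<exists>!c. ?P c" using G xm GL unfolding graded_algebra_def by blast
  have supp: "{i. c i \<noteq> \<zero>\<^bsub>L\<^esub>} \<subseteq> N" using z by blast
  have "(\<Oplus>\<^bsub>L\<^esub>i\<in>{i. c i \<noteq> \<zero>\<^bsub>L\<^esub>}. c i) = (\<Oplus>\<^bsub>L\<^esub>i\<in>N. c i)"
    using N supp cL by (intro M.add.finprod_mono_neutral_cong_left) auto
  then have P1: "?P c" using cG xc finite_subset[OF supp N] by simp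
  \<comment> \<open>The decomposition concentrated in degree \<open>m\<close>. Its support may be
    empty, namely when \<open>x\<close> is zero, so only inclusion in \<open>{m}\<close> is
    claimed.\<close>
  let ?c = "\<lambda>i. if m = i then x else \<zero>\<^bsub>L\<^esub>"
  have supp': "{i. ?c i \<noteq> \<zero>\<^bsub>L\<^esub>} \<subseteq> {m}" by auto
  have "(\<Oplus>\<^bsub>L\<^esub>i\<in>{i. ?c i \<noteq> \<zero>\<^bsub>L\<^esub>}. ?c i) = (\<Oplus>\<^bsub>L\<^esub>i\<in>{m}. ?c i)"
    using xm GL by (intro M.add.finprod_mono_neutral_cong_left) auto
  also have "\<dots> = x" using xm GL by (intro M.add.finprod_singleton) auto
  finally have P2: "?P ?c" using G0 xm finite_subset[OF supp'] by auto
  have "c = ?c" using the1_equality[of ?P, OF ex1 P1] the1_equality[of ?P, OF ex1 P2] by simp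
  then have "c m = x" by (simp add: fun_eq_iff)
  then show ?thesis using c[of m] by simp
qed


section \<open>Weighted monomials\<close>

text \<open>Elements of \<open>T k\<close> have weight \<open>k + 1\<close>, so that all weights are positive.\<close>

inductive weighted_monomial :: "('l, 'n) ring_scheme \<Rightarrow> (nat \<Rightarrow> 'l set) \<Rightarrow> nat \<Rightarrow> 'l \<Rightarrow> bool"
  for L T where
    one: "weighted_monomial L T 0 \<one>\<^bsub>L\<^esub>"
  | mult: "\<lbrakk>t \<in> T k; weighted_monomial L T d x\<rbrakk> \<Longrightarrow>
      weighted_monomial L T (Suc k + d) (t \<otimes>\<^bsub>L\<^esub> x)"

text \<open>Since weights are positive, removing the first factor of a monomial strictly lowers its
  weight, and only the finitely many sets \<open>T k\<close> with \<open>k < d\<close> can supply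
  that factor.\<close>

lemma finite_weighted_monomials:
  assumes "\<And>k. finite (T k)"
  shows "finite {x. weighted_monomial L T d x}"
proof (induction d rule: less_induct)
  case (less d)
  let ?U = "\<Union>k<d. \<Union>t\<in>T k. (\<lambda>x. t \<otimes>\<^bsub>L\<^esub> x) ` {x. weighted_monomial L T (d - Suc k) x}"
  have "finite ?U" using assms less by auto
  moreover have "{x. weighted_monomial L T d x} \<subseteq> insert \<one>\<^bsub>L\<^esub> ?U"
  proof clarify
    fix x assume x: "weighted_monomial L T d x" "x \<notin> ?U"
    from x(1) show "x = \<one>\<^bsub>L\<^esub>"
      by cases (use x(2) in force)+
  qed
  ultimately show ?case by (meson finite.insertI finite_subset)
qed

lemma (in cring) weighted_monomial_closed:
  assumes "\<And>k. T k \<subseteq> carrier R" "weighted_monomial R T d x"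
  shows "x \<in> carrier R"
  using assms(2) by induction (use assms(1) in auto)

lemma (in cring) weighted_monomial_mult:
  assumes T: "\<And>k. T k \<subseteq> carrier R"
    and x: "weighted_monomial R T d x" and y: "weighted_monomial R T e y"
  shows "weighted_monomial R T (d + e) (x \<otimes> y)"
  using x
proof induction
  case one
  then show ?case using y weighted_monomial_closed[OF T y] by simp
next
  case (mult t k d x)
  have "t \<otimes> x \<otimes> y = t \<otimes> (x \<otimes> y)"
    using T mult weighted_monomial_closed[OF T] y by (intro m_assoc) auto
  then show ?case
    using weighted_monomial.mult[OF mult(1,3)] by (simp add: add.assoc)
qed

text \<open>The monomials of all weights contain \<open>1\<close> and are closed under products, so
  bilinearity makes their span a ring. This takes two rounds: \<open>mult1\<close> multiplies a
  monomial by an element of the span, \<open>mult2\<close> two elements of the span.\<close>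

lemma span_weighted_monomials_subring:
  assumes "algebra A L" and T: "\<And>k. T k \<subseteq> carrier L"
  defines "S \<equiv> {x. \<exists>d. weighted_monomial L T d x}"
  shows "subring (module_span A L S) L"
proof -
  interpret L: cring L by (rule algebra.M_cring[OF assms(1)])
  interpret module A L by (rule algebra.module[OF assms(1)])
  note smult_assoc2 = algebra.smult_assoc2[OF assms(1)]
  have S: "S \<subseteq> carrier L" using L.weighted_monomial_closed[OF T] by (auto simp: S_def)
  note sub = module_span_submodule[OF S]
  have mult1: "s \<otimes>\<^bsub>L\<^esub> y \<in> module_span A L S" if s: "s \<in> S" and y: "y \<in> module_span A L S" for s y
    using y
  proof induction
    case zero
    then show ?case using subsetD[OF S s] by (simp add: module_span.zero)
  next
    case (insert a t y)
    have cl: "s \<in> carrier L" "t \<in> carrier L" "y \<in> carrier L"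
      using S s insert module_span_in_carrier[OF S] by auto
    have "s \<otimes>\<^bsub>L\<^esub> t \<in> S"
      using s insert(2) L.weighted_monomial_mult[of T _ s _ t, OF T] unfolding S_def by auto
    moreover have "s \<otimes>\<^bsub>L\<^esub> (a \<odot>\<^bsub>L\<^esub> t \<oplus>\<^bsub>L\<^esub> y) = a \<odot>\<^bsub>L\<^esub> (s \<otimes>\<^bsub>L\<^esub> t) \<oplus>\<^bsub>L\<^esub> s \<otimes>\<^bsub>L\<^esub> y"
      using cl insert(1) smult_assoc2[of a t s]
      by (simp add: L.r_distr L.m_comm)
    ultimately show ?case using insert by (auto intro: module_span.insert)
  qed
  have mult2: "x \<otimes>\<^bsub>L\<^esub> y \<in> module_span A L S"
    if x: "x \<in> module_span A L S" and y: "y \<in> module_span A L S" for x y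
    using x
  proof induction
    case zero
    then show ?case using module_span_in_carrier[OF S y] by (simp add: module_span.zero)
  next
    case (insert a s x)
    have cl: "s \<in> carrier L" "x \<in> carrier L" "y \<in> carrier L"
      using S y insert module_span_in_carrier[OF S] by auto
    have "(a \<odot>\<^bsub>L\<^esub> s \<oplus>\<^bsub>L\<^esub> x) \<otimes>\<^bsub>L\<^esub> y = a \<odot>\<^bsub>L\<^esub> (s \<otimes>\<^bsub>L\<^esub> y) \<oplus>\<^bsub>L\<^esub> x \<otimes>\<^bsub>L\<^esub> y"
      using cl insert(1) by (simp add: L.l_distr smult_assoc2)
    then show ?case
      using insert mult1[OF _ y] module_span_smult[OF S] module_span_add[OF S] by auto
  qed
  have "\<one>\<^bsub>L\<^esub> \<in> S" using weighted_monomial.one[of L T] unfolding S_def by blast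
  then show ?thesis
    using submoduleE[OF sub] mult2 module_span_base[OF S]
    by (intro L.subringI) auto
qed


section \<open>Substitution of power series\<close>

text \<open>A sum over an infinite index set is zero by convention and so lies in \<open>Q\<close>
  as well. Hence the index sets in products and substitutions of series never have to be shown
  finite.\<close>

lemma (in ring) subring_finsum_closed:
  assumes Q: "subring Q R" and f: "f \<in> I \<rightarrow> Q"
  shows "(\<Oplus>i\<in>I. f i) \<in> Q"
  using f
proof (induction I rule: infinite_finite_induct)
  case (insert i I)
  then have "(\<Oplus>i\<in>insert i I. f i) = f i \<oplus> (\<Oplus>i\<in>I. f i)"
    using subringE(1)[OF Q] by (intro finsum_insert) auto
  then show ?case using insert subringE(7)[OF Q] by auto
qed (use subringE(2)[OF Q] in auto)

context ring
begin

context
  fixes Q assumes Q: "subring Q R"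
begin

lemma pseries_mult_in_subring:
  assumes "range f \<subseteq> Q" "range g \<subseteq> Q"
  shows "range (f \<otimes>\<^bsub>pseries R\<^esub> g) \<subseteq> Q"
proof -
  have "f i \<in> Q" "g i \<in> Q" for i using assms by blast+
  then show ?thesis
    by (auto simp: pseries_def intro!: subring_finsum_closed[OF Q] subringE(6)[OF Q])
qed

lemma pseries_pow_in_subring:
  assumes "range g \<subseteq> Q"
  shows "range (g [^]\<^bsub>pseries R\<^esub> (n::nat)) \<subseteq> Q"
proof (induction n)
  case 0
  then show ?case using subringE(2,3)[OF Q] by (auto simp: pseries_def)
next
  case (Suc n)
  then show ?case using pseries_mult_in_subring[OF Suc assms] by simp
qed

lemma psubst_in_subring:
  assumes "range f \<subseteq> Q" "range g \<subseteq> Q"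
  shows "range (psubst R f g) \<subseteq> Q"
proof -
  have "f i \<in> Q" "(g [^]\<^bsub>pseries R\<^esub> (i::nat)) e \<in> Q" for i e
    using assms pseries_pow_in_subring[OF assms(2)] by blast+
  then show ?thesis
    by (auto simp: psubst_def intro!: subring_finsum_closed[OF Q] subringE(6)[OF Q])
qed

lemma psubst2_in_subring:
  assumes "range F \<subseteq> Q" "range g \<subseteq> Q" "range h \<subseteq> Q"
  shows "range (psubst2 R F g h) \<subseteq> Q"
proof -
  have "F p \<in> Q" for p using assms(1) by blast
  moreover have "(g [^]\<^bsub>pseries R\<^esub> (i::nat) \<otimes>\<^bsub>pseries R\<^esub> h [^]\<^bsub>pseries R\<^esub> (j::nat)) e \<in> Q" for i j e
    using pseries_mult_in_subring[OF assms(2,3)[THEN pseries_pow_in_subring], of i j] by blast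
  ultimately show ?thesis
    by (auto simp: psubst2_def Let_def intro!: subring_finsum_closed[OF Q] subringE(6)[OF Q])
qed

end

lemma monomial_closed: "monomial R d e \<in> carrier R"
  by (simp add: monomial_def)

lemmas pseries_mult_closed = pseries_mult_in_subring[OF carrier_is_subring]
lemmas pseries_pow_closed = pseries_pow_in_subring[OF carrier_is_subring]
lemmas psubst_closed = psubst_in_subring[OF carrier_is_subring]
lemmas psubst2_closed = psubst2_in_subring[OF carrier_is_subring]

end

section \<open>Series operations under ring homomorphisms\<close>

context ring_hom_cring
begin

lemma comp_monomial: "h \<circ> monomial R d = monomial S d"
  by (auto simp: monomial_def)

lemma comp_pseries_mult:
  assumes "range f \<subseteq> carrier R" "range g \<subseteq> carrier R"
  shows "h \<circ> (f \<otimes>\<^bsub>pseries R\<^esub> g) = (h \<circ> f) \<otimes>\<^bsub>pseries S\<^esub> (h \<circ> g)"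
proof
  fix e
  have "f i \<in> carrier R" "g i \<in> carrier R" for i using assms by auto
  then show "(h \<circ> (f \<otimes>\<^bsub>pseries R\<^esub> g)) e = ((h \<circ> f) \<otimes>\<^bsub>pseries S\<^esub> (h \<circ> g)) e"
    by (auto simp: pseries_def intro!: S.finsum_cong')
qed

lemma comp_pseries_pow:
  assumes "range g \<subseteq> carrier R"
  shows "h \<circ> (g [^]\<^bsub>pseries R\<^esub> (n::nat)) = (h \<circ> g) [^]\<^bsub>pseries S\<^esub> n"
proof (induction n)
  case 0
  then show ?case by (auto simp: pseries_def)
next
  case (Suc n)
  then show ?case using comp_pseries_mult[OF R.pseries_pow_closed[OF assms] assms] by (simp del: o_apply)
qed

context
  assumes inj: "inj_on h (carrier R)"
begin

text \<open>The sums defining a substitution run over the indices with nonzero coefficient. For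
  injective \<open>h\<close> these index sets agree over \<open>R\<close> and over \<open>S\<close>,
  which is what makes \<open>h\<close> commute with substitution term by term.\<close>

lemma hom_eq_zero_iff:
  assumes "x \<in> carrier R"
  shows "h x = \<zero>\<^bsub>S\<^esub> \<longleftrightarrow> x = \<zero>"
  using inj_onD[OF inj, of x \<zero>] assms by auto

lemma comp_psubst:
  assumes "range f \<subseteq> carrier R" "range g \<subseteq> carrier R"
  shows "h \<circ> psubst R f g = psubst S (h \<circ> f) (h \<circ> g)"
proof
  fix e
  have cl: "f i \<in> carrier R" "(g [^]\<^bsub>pseries R\<^esub> i) e \<in> carrier R" for i :: nat
    using assms R.pseries_pow_closed[OF assms(2)] by blast+
  have pow: "((h \<circ> g) [^]\<^bsub>pseries S\<^esub> i) e = h ((g [^]\<^bsub>pseries R\<^esub> i) e)" for i :: nat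
    using comp_pseries_pow[OF assms(2), of i] by (metis comp_apply)
  show "(h \<circ> psubst R f g) e = psubst S (h \<circ> f) (h \<circ> g) e"
    using cl by (auto simp: psubst_def pow hom_eq_zero_iff intro!: S.finsum_cong')
qed

lemma comp_psubst2:
  assumes "range F \<subseteq> carrier R" "range f \<subseteq> carrier R" "range g \<subseteq> carrier R"
  shows "h \<circ> psubst2 R F f g = psubst2 S (h \<circ> F) (h \<circ> f) (h \<circ> g)"
proof
  fix e
  let ?m = "\<lambda>i j. f [^]\<^bsub>pseries R\<^esub> (i::nat) \<otimes>\<^bsub>pseries R\<^esub> g [^]\<^bsub>pseries R\<^esub> (j::nat)"
  have cl1: "F p \<in> carrier R" for p using assms(1) by blast
  have cl2: "?m i j e \<in> carrier R" for i j
    using R.pseries_mult_closed[OF assms(2,3)[THEN R.pseries_pow_closed], of i j] by blast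
  have pow: "((h \<circ> f) [^]\<^bsub>pseries S\<^esub> i \<otimes>\<^bsub>pseries S\<^esub> (h \<circ> g) [^]\<^bsub>pseries S\<^esub> j) e = h (?m i j e)"
    for i j :: nat
    using comp_pseries_mult[OF R.pseries_pow_closed[OF assms(2)] R.pseries_pow_closed[OF assms(3)], of i j]
      comp_pseries_pow[OF assms(2), of i] comp_pseries_pow[OF assms(3), of j]
    by (metis comp_apply)
  show "(h \<circ> psubst2 R F f g) e = psubst2 S (h \<circ> F) (h \<circ> f) (h \<circ> g) e"
    using cl1 cl2 by (auto simp: psubst2_def Let_def pow hom_eq_zero_iff intro!: S.finsum_cong')
qed

lemma comp_eqD:
  assumes "h \<circ> f = h \<circ> g" "range f \<subseteq> carrier R" "range g \<subseteq> carrier R"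
  shows "f = g"
proof
  fix e
  show "f e = g e"
    using assms(2,3) fun_cong[OF assms(1), of e] by (intro inj_onD[OF inj]) auto
qed

text \<open>Each axiom equates two series over \<open>R\<close>. Their images under \<open>h\<close>
  agree over \<open>S\<close>, and injectivity cancels \<open>h\<close>.\<close>

lemma formal_group_law_reflect:
  assumes F: "range F \<subseteq> carrier R" and "formal_group_law S (h \<circ> F)"
  shows "formal_group_law R F"
proof -
  note FS = assms(2)[unfolded formal_group_law_def Let_def]
  note cl = F R.monomial_closed[THEN image_subsetI] R.psubst2_closed
  have "(\<lambda>i. F (i, 0)) = monomial R 1"
    by (rule comp_eqD) (use FS F R.monomial_closed in \<open>auto simp: comp_monomial[unfolded o_def] o_def\<close>)
  moreover have "(\<lambda>j. F (0, j)) = monomial R 1"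
    by (rule comp_eqD) (use FS F R.monomial_closed in \<open>auto simp: comp_monomial[unfolded o_def] o_def\<close>)
  moreover have "F (i, j) = F (j, i)" for i j
    using FS F by (intro inj_onD[OF inj]) auto
  moreover have "psubst2 R F (psubst2 R F (monomial R (1, 0, 0)) (monomial R (0, 1, 0))) (monomial R (0, 0, 1))
    = psubst2 R F (monomial R (1, 0, 0)) (psubst2 R F (monomial R (0, 1, 0))
       (monomial R (0, 0, 1 :: nat) :: nat \<times> nat \<times> nat \<Rightarrow> 'a))"
    using FS by (intro comp_eqD) (auto simp: comp_psubst2 comp_monomial cl intro!: cl)
  ultimately show ?thesis
    using F by (simp add: formal_group_law_def Let_def pseries_def)
qed

end
end


section \<open>Subalgebras containing the coefficients of a formal module\<close>

text \<open>As for formal group laws, every axiom can be tested after the injection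
  \<open>h\<close>. This turns a formal module whose coefficients lie in a subalgebra into one over
  that subalgebra.\<close>

lemma formal_module_reflect:
  assumes A: "algebra A R" "algebra A S" and h: "h \<in> algebra_hom A R S" and inj: "inj_on h (carrier R)"
    and F: "range F \<subseteq> carrier R" and \<rho>: "\<And>a. a \<in> carrier A \<Longrightarrow> range (\<rho> a) \<subseteq> carrier R"
    and FM: "formal_module A S (h \<circ> F) (\<lambda>a. h \<circ> \<rho> a)"
  shows "formal_module A R F \<rho>"
proof -
  interpret A: cring A using A(1) by (rule algebra.R_cring)
  have hr: "h \<in> ring_hom R S" and hs: "\<And>a x. a \<in> carrier A \<Longrightarrow> x \<in> carrier R \<Longrightarrow> h (a \<odot>\<^bsub>R\<^esub> x) = a \<odot>\<^bsub>S\<^esub> h x"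
    using h by (auto simp: algebra_hom_def)
  interpret ring_hom_cring R S h
    using A hr by (auto intro!: ring_hom_cring.intro ring_hom_cring_axioms.intro algebra.M_cring)
  note hom = FM[unfolded formal_module_def, THEN conjunct2, THEN conjunct1]
  note fgl = FM[unfolded formal_module_def, THEN conjunct1]
  have smult_one: "a \<odot>\<^bsub>R\<^esub> \<one>\<^bsub>R\<^esub> \<in> carrier R" if "a \<in> carrier A" for a
    using module.smult_closed[OF algebra.module[OF A(1)] that R.one_closed] .
  note eqI = comp_eqD[OF inj] and comp = comp_psubst[OF inj] comp_psubst2[OF inj] comp_monomial
  note cl = R.psubst_closed R.psubst2_closed R.monomial_closed[THEN image_subsetI] F \<rho>
  have "\<rho> \<in> ring_hom A (fgl_End R F)"
  proof (rule ring_hom_memI)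
    fix a assume a: "a \<in> carrier A"
    have hx: "h \<circ> \<rho> a \<in> carrier (fgl_End S (h \<circ> F))"
      using ring_hom_closed[OF hom a] .
    have "\<rho> a 0 = \<zero>\<^bsub>R\<^esub>"
      using hx \<rho>[OF a] hom_eq_zero_iff[OF inj, of "\<rho> a 0"] by (auto simp: fgl_End_def)
    moreover have "psubst R (\<rho> a) F
        = psubst2 R F (psubst R (\<rho> a) (monomial R (1, 0))) (psubst R (\<rho> a) (monomial R (0, 1)))"
      by (rule eqI) (use hx in \<open>simp_all add: comp cl a fgl_End_def del: One_nat_def o_apply\<close>)
    ultimately show "\<rho> a \<in> carrier (fgl_End R F)"
      using \<rho>[OF a] by (simp add: fgl_End_def pseries_def)
  next
    fix a b assume ab: "a \<in> carrier A" "b \<in> carrier A"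
    have "\<rho> (a \<otimes>\<^bsub>A\<^esub> b) = psubst R (\<rho> a) (\<rho> b)"
      by (rule eqI) (use ring_hom_mult[OF hom ab] ab in \<open>simp_all add: comp cl fgl_End_def del: o_apply\<close>)
    then show "\<rho> (a \<otimes>\<^bsub>A\<^esub> b) = \<rho> a \<otimes>\<^bsub>fgl_End R F\<^esub> \<rho> b" by (simp add: fgl_End_def)
    have "\<rho> (a \<oplus>\<^bsub>A\<^esub> b) = psubst2 R F (\<rho> a) (\<rho> b)"
      by (rule eqI) (use ring_hom_add[OF hom ab] ab in \<open>simp_all add: comp cl fgl_End_def del: o_apply\<close>)
    then show "\<rho> (a \<oplus>\<^bsub>A\<^esub> b) = \<rho> a \<oplus>\<^bsub>fgl_End R F\<^esub> \<rho> b" by (simp add: fgl_End_def)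
  next
    have "\<rho> \<one>\<^bsub>A\<^esub> = monomial R 1"
      by (rule eqI) (use ring_hom_one[OF hom] in \<open>simp_all add: comp cl fgl_End_def del: One_nat_def o_apply\<close>)
    then show "\<rho> \<one>\<^bsub>A\<^esub> = \<one>\<^bsub>fgl_End R F\<^esub>" by (simp add: fgl_End_def)
  qed
  moreover have "\<rho> a 1 = a \<odot>\<^bsub>R\<^esub> \<one>\<^bsub>R\<^esub>" if a: "a \<in> carrier A" for a
  proof (rule inj_onD[OF inj])
    show "h (\<rho> a 1) = h (a \<odot>\<^bsub>R\<^esub> \<one>\<^bsub>R\<^esub>)"
      using FM a hs[OF a R.one_closed] by (simp add: formal_module_def)
  qed (use \<rho>[OF a] smult_one[OF a] in auto)
  ultimately show ?thesis
    using formal_group_law_reflect[OF inj F fgl] by (simp add: formal_module_def)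
qed

text \<open>Addition in \<open>End(F)\<close> is substitution into \<open>F\<close> and
  multiplication is composition. Both form new coefficients from old ones by ring operations, so
  they stay within \<open>Q\<close>; induction over the generation of \<open>A\<close> does the
  rest.\<close>

lemma formal_module_coeffs_in_subring:
  assumes "cring A" "algebra A L" and FM: "formal_module A L F \<rho>"
    and Q: "subring Q L" and F: "range F \<subseteq> Q"
    and S: "S \<subseteq> carrier A" "generate_ring A S = carrier A"
    and \<rho>S: "\<And>a. a \<in> insert (\<ominus>\<^bsub>A\<^esub> \<one>\<^bsub>A\<^esub>) S \<Longrightarrow> range (\<rho> a) \<subseteq> Q"
    and a: "a \<in> carrier A"
  shows "range (\<rho> a) \<subseteq> Q"
proof -
  interpret A: cring A by fact
  interpret L: cring L by (rule algebra.M_cring) fact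
  have hom: "\<rho> \<in> ring_hom A (fgl_End L F)" using FM by (simp add: formal_module_def)
  have mult: "range (\<rho> (a \<otimes>\<^bsub>A\<^esub> b)) \<subseteq> Q"
    if "a \<in> carrier A" "b \<in> carrier A" "range (\<rho> a) \<subseteq> Q" "range (\<rho> b) \<subseteq> Q" for a b
    using L.psubst_in_subring[OF Q that(3,4)] ring_hom_mult[OF hom that(1,2)]
    by (simp add: fgl_End_def)
  from a show ?thesis
    unfolding S(2)[symmetric]
  proof induction
    case one
    have "\<rho> \<one>\<^bsub>A\<^esub> = monomial L 1" using ring_hom_one[OF hom] by (simp add: fgl_End_def)
    then show ?case using subringE(2,3)[OF Q] by (auto simp: monomial_def)
  next
    case (incl a)
    then show ?case using \<rho>S by auto
  next
    case (a_inv a)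
    then have a: "a \<in> carrier A" using S(2) by simp
    \<comment> \<open>Negation becomes composition with \<open>\<rho>\<close> of \<open>-1\<close>,
      in place of the formal inverse series of \<open>F\<close>. This is why \<open>-1\<close> is
      listed with the generators.\<close>
    then have "\<ominus>\<^bsub>A\<^esub> a = (\<ominus>\<^bsub>A\<^esub> \<one>\<^bsub>A\<^esub>) \<otimes>\<^bsub>A\<^esub> a" by (simp add: A.l_minus)
    then show ?case using mult[OF _ a] a_inv.IH \<rho>S by simp
  next
    case (eng_add a b)
    then have "a \<in> carrier A" "b \<in> carrier A" using S(2) by auto
    from ring_hom_add[OF hom this] show ?case
      using L.psubst2_in_subring[OF Q F eng_add.IH] by (simp add: fgl_End_def)
  next
    case (eng_mult a b)
    then show ?case using mult S(2) by auto
  qed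
qed


section \<open>The classifying ring is generated by the universal coefficients\<close>

text \<open>Moves a subalgebra \<open>K\<close> of \<open>L\<close> to the type over which the test algebras range.\<close>

definition image_algebra :: "('l \<Rightarrow> 'b) \<Rightarrow> 'l set \<Rightarrow> ('a, 'l, 'n) module_scheme \<Rightarrow> ('a, 'b) module" where
  "image_algebra i K L =
    \<lparr> carrier = i ` K,
      mult = (\<lambda>x y. i (inv_into UNIV i x \<otimes>\<^bsub>L\<^esub> inv_into UNIV i y)),
      one = i \<one>\<^bsub>L\<^esub>,
      zero = i \<zero>\<^bsub>L\<^esub>,
      add = (\<lambda>x y. i (inv_into UNIV i x \<oplus>\<^bsub>L\<^esub> inv_into UNIV i y)),
      smult = (\<lambda>a x. i (a \<odot>\<^bsub>L\<^esub> inv_into UNIV i x)) \<rparr>"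

context
  fixes A :: "('a, 'm) ring_scheme" and L :: "('a, 'l, 'n) module_scheme" and K and i :: "'l \<Rightarrow> 'b"
  assumes L: "algebra A L" and K: "subring K L" "submodule K A L" and i: "inj i"
begin

lemma algebra_image_algebra: "algebra A (image_algebra i K L)"
proof -
  interpret L: cring L by (rule algebra.M_cring[OF L])
  interpret module A L by (rule algebra.module[OF L])
  note smult_assoc2 = algebra.smult_assoc2[OF L]
  note K_simps [simp] = subringE(2,3,5,6,7)[OF K(1)] submoduleE(4)[OF K(2)] inv_f_f[OF i]
  have [simp]: "x \<in> carrier L" if "x \<in> K" for x using that subringE(1)[OF K(1)] by auto
  have neg: "\<exists>y\<in>K. i (x \<oplus>\<^bsub>L\<^esub> y) = i \<zero>\<^bsub>L\<^esub>" if "x \<in> K" for x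
    using that by (intro bexI[of _ "\<ominus>\<^bsub>L\<^esub> x"]) (auto simp: L.r_neg)
  show ?thesis
  proof (rule algebraI)
    show "cring (image_algebra i K L)"
    proof (rule cringI)
      show "abelian_group (image_algebra i K L)"
        by (rule abelian_groupI) (auto simp: image_algebra_def L.a_ac neg)
      show "comm_monoid (image_algebra i K L)"
        by (rule comm_monoidI) (auto simp: image_algebra_def L.m_ac)
    qed (auto simp: image_algebra_def L.l_distr)
  qed (auto simp: image_algebra_def R.is_cring smult_l_distr smult_r_distr smult_assoc1 smult_assoc2)
qed

lemma inv_image_algebra_hom: "inv_into UNIV i \<in> algebra_hom A (image_algebra i K L) L"
  using subsetD[OF subringE(1)[OF K(1)]] i
  by (auto simp: algebra_hom_def image_algebra_def intro!: ring_hom_memI)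

text \<open>Reflection along the inverse of \<open>i\<close>, which embeds the transported copy of
  \<open>K\<close> into \<open>L\<close> and sends \<open>i \<circ> F\<close> back to
  \<open>F\<close>.\<close>

lemma formal_module_image_algebra:
  assumes FM: "formal_module A L F \<rho>" and F: "range F \<subseteq> K"
    and \<rho>: "\<And>a. a \<in> carrier A \<Longrightarrow> range (\<rho> a) \<subseteq> K"
  shows "formal_module A (image_algebra i K L) (i \<circ> F) (\<lambda>a. i \<circ> \<rho> a)"
proof (rule formal_module_reflect[OF algebra_image_algebra L inv_image_algebra_hom])
  show "inj_on (inv_into UNIV i) (carrier (image_algebra i K L))"
    using i by (auto simp: image_algebra_def intro!: inj_onI)
  have inv: "inv_into UNIV i \<circ> (i \<circ> f) = f" for f :: "'x \<Rightarrow> 'l" using i by (simp add: o_def)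
  show "formal_module A L (inv_into UNIV i \<circ> (i \<circ> F)) (\<lambda>a. inv_into UNIV i \<circ> (i \<circ> \<rho> a))"
    using FM by (simp add: inv del: o_apply)
  show "range (i \<circ> F) \<subseteq> carrier (image_algebra i K L)"
    using F by (auto simp: image_algebra_def)
  show "range (i \<circ> \<rho> a) \<subseteq> carrier (image_algebra i K L)" if "a \<in> carrier A" for a
    using \<rho>[OF that] by (auto simp: image_algebra_def)
qed

end

text \<open>The classifying map \<open>L \<rightarrow> K\<close> followed by the inclusion, and the identity, both classify \<open>(F, \<rho>)\<close>
  over \<open>L\<close>, so they agree.\<close>

lemma corepresenting_algebra_minimal:
  fixes A :: "('a, 'm) ring_scheme" and L :: "('a, 'l) module"
  assumes rep: "corepresents_formal_modules A L F \<rho>"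
    and K: "subring K L" "submodule K A L" and F: "range F \<subseteq> K"
    and \<rho>: "\<And>a. a \<in> carrier A \<Longrightarrow> range (\<rho> a) \<subseteq> K"
  shows "K = carrier L"
proof
  show KL: "K \<subseteq> carrier L" using subringE(1)[OF K(1)] .
  have L: "algebra A L" and FM: "formal_module A L F \<rho>"
    using rep by (auto simp: corepresents_formal_modules_def)
  interpret L: cring L by (rule algebra.M_cring[OF L])
  interpret module A L by (rule algebra.module[OF L])
  let ?i = "Inl :: 'l \<Rightarrow> 'l + 'a list"
  let ?cl = "\<lambda>R \<phi>. \<phi> \<in> algebra_hom A L R \<and> \<phi> \<in> extensional (carrier L) \<and>
              (\<forall>i j. \<phi> (F (i, j)) = (?i \<circ> F) (i, j)) \<and>
              (\<forall>a \<in> carrier A. \<forall>i. \<phi> (\<rho> a i) = (?i \<circ> \<rho> a) i)"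
  have inj: "inj ?i" by simp
  have F': "range F \<subseteq> carrier L" and \<rho>': "\<And>a. a \<in> carrier A \<Longrightarrow> range (\<rho> a) \<subseteq> carrier L"
    using F \<rho> KL by blast+
  note carrier_sub = L.carrier_is_subring carrier_is_submodule
  \<comment> \<open>Taken with \<open>H = K\<close> for the existence of a classifying map, and with
    \<open>H\<close> the carrier of \<open>L\<close> for its uniqueness.\<close>
  have ex: "\<exists>!\<phi>. ?cl (image_algebra ?i H L) \<phi>"
    if "subring H L" "submodule H A L" "range F \<subseteq> H" "\<And>a. a \<in> carrier A \<Longrightarrow> range (\<rho> a) \<subseteq> H" for H
    using rep algebra_image_algebra[OF L that(1,2) inj]
      formal_module_image_algebra[OF L that(1,2) inj FM that(3,4)]
    unfolding corepresents_formal_modules_def by blast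
  obtain \<phi> where \<phi>: "?cl (image_algebra ?i K L) \<phi>"
    using ex[OF K F \<rho>] by blast
  \<comment> \<open>Passing from \<open>K\<close> to all of \<open>L\<close> enlarges the carrier of
    the target and leaves its operations alone, so \<open>\<phi>\<close> remains a classifying
    map.\<close>
  have "?cl (image_algebra ?i (carrier L) L) \<phi>"
    using \<phi> image_mono[OF KL, of ?i]
    by (auto simp: algebra_hom_def ring_hom_def image_algebra_def Pi_iff)
  \<comment> \<open>Classifying maps are extensional, so the competing map is \<open>Inl\<close>
    restricted to the carrier of \<open>L\<close>.\<close>
  moreover have "?cl (image_algebra ?i (carrier L) L) (restrict ?i (carrier L))"
    using F' \<rho>' inv_f_f[OF inj]
    by (auto simp: algebra_hom_def image_algebra_def image_subset_iff intro!: ring_hom_memI)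
  ultimately have eq: "\<phi> = restrict ?i (carrier L)"
    using ex[OF carrier_sub F' \<rho>'] by blast
  show "carrier L \<subseteq> K"
  proof
    fix x assume x: "x \<in> carrier L"
    then have "\<phi> x \<in> ?i ` K"
      using \<phi> by (auto simp: algebra_hom_def ring_hom_def image_algebra_def)
    then show "x \<in> K" using eq x by auto
  qed
qed

section \<open>Degrees of monomials and finiteness in each degree\<close>

lemma weighted_monomial_degree:
  assumes G: "graded_algebra A L G" and T: "\<And>k. T k \<subseteq> G (2 * (int k + 1))"
    and x: "weighted_monomial L T d x"
  shows "x \<in> G (2 * int d)"
  using x
proof induction
  case one
  then show ?case using G by (simp add: graded_algebra_def)
next
  case (mult t k d x)
  have "t \<in> G (2 * (int k + 1))" using T mult(1) by blast
  then have "t \<otimes>\<^bsub>L\<^esub> x \<in> G (2 * (int k + 1) + 2 * int d)"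
    using G mult(3) unfolding graded_algebra_def by blast
  then show ?case by (simp add: algebra_simps)
qed

theorem proposition2p6:
  fixes A :: "('a, 'n) ring_scheme"
    and L :: "('a, 'l) module"
    and F :: "nat \<times> nat \<Rightarrow> 'l"
    and \<rho> :: "'a \<Rightarrow> nat \<Rightarrow> 'l"
    and G :: "int \<Rightarrow> 'l set"
    and m :: int
  assumes "cring A"
    and "torsion_free A"
    and "finitely_generated_ring A"
    and "corepresents_formal_modules A L F \<rho>"
    and "classifying_grading A L F \<rho> G"
  shows "finitely_generated_module A (L\<lparr>carrier := G m\<rparr>)"
proof -
  have L: "algebra A L" and FM: "formal_module A L F \<rho>"
    using assms(4) by (auto simp: corepresents_formal_modules_def)
  interpret A: cring A by fact
  interpret L: cring L by (rule algebra.M_cring[OF L])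
  interpret module A L by (rule algebra.module[OF L])
  have G: "graded_algebra A L G" and FG: "\<And>i j. F (i, j) \<in> G (2 * (int i + int j - 1))"
    and \<rho>G: "\<And>a i. a \<in> carrier A \<Longrightarrow> \<rho> a i \<in> G (2 * (int i - 1))"
    using assms(5) by (auto simp: classifying_grading_def)
  have sub: "submodule (G k) A L" for k using G by (simp add: graded_algebra_def)
  have GL: "G k \<subseteq> carrier L" for k by (rule submoduleE(1)[OF sub])
  obtain S where S: "finite S" "S \<subseteq> carrier A" "generate_ring A S = carrier A"
    using assms(3) by (auto simp: finitely_generated_ring_def)
  define S' where "S' = insert (\<ominus>\<^bsub>A\<^esub> \<one>\<^bsub>A\<^esub>) S"
  have S': "finite S'" "S' \<subseteq> carrier A" using S by (auto simp: S'_def)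
  \<comment> \<open>The members of \<open>T k\<close> have degree \<open>2 * (k + 1)\<close>: the
    total exponent \<open>i + j\<close>, or the index of the coefficient of \<open>\<rho> a\<close>,
    is \<open>k + 2\<close>. The shift by 2 leaves out the constant and linear coefficients, so
    every generator has positive degree.\<close>
  define T where "T k = F ` {(i, j). i + j = k + 2} \<union> (\<lambda>a. \<rho> a (k + 2)) ` S'" for k
  have fin: "finite (T k)" for k
  proof -
    have "{(i, j). i + j = k + 2} \<subseteq> {..k + 2} \<times> {..k + 2}" by auto
    from finite_subset[OF this] show ?thesis using S' by (simp add: T_def)
  qed
  have TG: "T k \<subseteq> G (2 * (int k + 1))" for k
  proof -
    have "F (i, j) \<in> G (2 * (int k + 1))" if "i + j = k + 2" for i j
    proof -
      have "int i + int j - 1 = int k + 1" using that by linarith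
      then show ?thesis using FG[of i j] by (simp only:)
    qed
    moreover have "\<rho> a (k + 2) \<in> G (2 * (int k + 1))" if "a \<in> S'" for a
      using \<rho>G[of a "k + 2"] that S' by (auto simp: add.commute)
    ultimately show ?thesis by (auto simp: T_def)
  qed
  then have TL: "T k \<subseteq> carrier L" for k using GL by blast
  \<comment> \<open>The same monomials indexed by degree, which is twice the weight. For odd or
    negative \<open>k\<close> the set is empty and its span is zero.\<close>
  define V where "V k = {x. \<exists>d. k = 2 * int d \<and> weighted_monomial L T d x}" for k
  have VG: "V k \<subseteq> G k" for k using weighted_monomial_degree[OF G TG] by (auto simp: V_def)
  then have VL: "V k \<subseteq> carrier L" for k using GL by blast
  have "V k \<subseteq> {x. weighted_monomial L T (nat (k div 2)) x}" for k by (auto simp: V_def)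
  then have finV: "finite (V k)" for k
    using finite_weighted_monomials[of T, OF fin] finite_subset by blast
  let ?Q = "module_span A L (\<Union>k. V k)"
  have UV: "(\<Union>k. V k) = {x. \<exists>d. weighted_monomial L T d x}" by (auto simp: V_def)
  have UVL: "(\<Union>k. V k) \<subseteq> carrier L" using VL by blast
  have Q: "subring ?Q L" "submodule ?Q A L"
    using span_weighted_monomials_subring[of A L T, OF L TL] module_span_submodule[OF UVL]
    by (simp_all add: UV)
  have TQ: "t \<in> ?Q" if "t \<in> T k" for t k
  proof -
    \<comment> \<open>A generator is the monomial of weight \<open>k + 1\<close> with a single
      factor.\<close>
    have "weighted_monomial L T (Suc k + 0) (t \<otimes>\<^bsub>L\<^esub> \<one>\<^bsub>L\<^esub>)"
      using that by (intro weighted_monomial.intros)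
    moreover have "t \<otimes>\<^bsub>L\<^esub> \<one>\<^bsub>L\<^esub> = t" using that TL by (intro L.r_one) blast
    ultimately have "t \<in> (\<Union>k. V k)" unfolding UV by auto
    then show ?thesis by (rule module_span_base[OF UVL])
  qed
  \<comment> \<open>By the unit axioms the coefficients on the two axes are 0 or 1. Among them are
    those of total exponent at most 1, which no \<open>T k\<close> contains. Elsewhere both
    exponents are positive, so \<open>i + j - 2\<close> below is not truncated.\<close>
  have FX: "F (i, 0) = monomial L 1 i" "F (0, i) = monomial L 1 i" for i
    using FM by (auto simp: formal_module_def formal_group_law_def fun_eq_iff)
  have mon: "monomial L (1::nat) i \<in> ?Q" for i
    using subringE(2,3)[OF Q(1)] by (simp add: monomial_def)
  have "F (i, j) \<in> ?Q" for i j
  proof (cases "i = 0 \<or> j = 0")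
    case True
    then show ?thesis using FX mon by auto
  next
    case False
    then have "F (i, j) \<in> T (i + j - 2)" by (auto simp: T_def)
    then show ?thesis by (rule TQ)
  qed
  then have FQ: "range F \<subseteq> ?Q" by auto
  have \<rho>S: "range (\<rho> a) \<subseteq> ?Q" if "a \<in> S'" for a
  proof -
    have a: "a \<in> carrier A" using that S' by auto
    \<comment> \<open>The constant coefficient of an endomorphism is zero and the linear one is the
      scalar \<open>a\<close> times \<open>1\<close>; all higher ones are in some
      \<open>T k\<close>.\<close>
    have "\<rho> a 0 \<in> ?Q"
      using FM a subringE(2)[OF Q(1)] ring_hom_closed[of \<rho> A "fgl_End L F" a]
      by (simp add: formal_module_def fgl_End_def)
    moreover have "\<rho> a 1 \<in> ?Q"
      using FM a subringE(3)[OF Q(1)] submoduleE(4)[OF Q(2)] by (simp add: formal_module_def)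
    moreover have "\<rho> a (k + 2) \<in> ?Q" for k
      by (rule TQ[of _ k]) (use that in \<open>auto simp: T_def\<close>)
    ultimately have "\<rho> a n \<in> ?Q" for n
      by (metis One_nat_def Suc_1 add.commute less_2_cases_iff not_less le_Suc_ex)
    then show ?thesis by auto
  qed
  have "?Q = carrier L"
    using corepresenting_algebra_minimal[OF assms(4) Q FQ]
      formal_module_coeffs_in_subring[OF assms(1) L FM Q(1) FQ S(2,3)] \<rho>S
    unfolding S'_def by blast
  \<comment> \<open>Since \<open>?Q\<close> is all of \<open>L\<close>, each element of
    \<open>G m\<close> is a combination of monomials, and only those of degree \<open>m\<close>
    contribute.\<close>
  then have "G m \<subseteq> module_span A L (V m)"
    using graded_component_of_span[OF G VG] GL by blast
  then have "G m = module_span A L (V m)"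
    using module_span_minimal[OF sub VG] by blast
  then show ?thesis using finitely_generated_module_span[OF VL finV] by simp
qed

end
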